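(* Let $\tau$ be an orientation of a set $S$ of separations of a finite set $V$, and suppose that $\tau$ has $m$ maximal elements. Then $\tau$ is induced by a function $w\colon V\to\mathbb{R}_{\ge0}$ on $V$ if and only if $\tau$ is $k$-locally $\ell$-induced for some $k\in\mathbb{N}$ and some real $\ell>0$ with $k>\frac{m}{1+1/\ell}$.
   Context: A separation of a finite set $V$ is an unordered pair $\{A,B\}$ of subsets of $V$ with $A\cup B=V$. Its two orientations are the ordered pairs $(A,B)$ and $(B,A)$. Oriented separations are partially ordered by $(A,B)\le (C,D)$ if and only if $A\subseteq C$ and $B\supseteq D$. Maximal elements of a set of oriented separations are those maximal in this order. An orientation of a set $S$ of (unoriented) separations of $V$ is a set $\tau$ consisting of exactly one orientation of each $s\in S$ (and nothing else). A weight function on $V$ is a map $w\colon V\to\mathbb{R}_{\ge0}$; for $Z\subseteq V$ write $w(Z)=\sum_{v\in Z}w(v)$. The function $w$ induces $\tau$ if $w(A)<w(B)$ for all $(A,B)\in\tau$. For $k\in\mathbb{N}$ and real $\ell\ge0$, an orientation $\tau$ of $S$ is $k$-locally $\ell$-induced if for every set $\mu'\subseteq\tau$ of size $|\mu'|\le k$ there is a weight function $w_{\mu'}$ on $V$ satisfying (i) $w_{\mu'}(B)-w_{\mu'}(A)\ge1$ for all $(A,B)\in\mu'$; and (ii) $w_{\mu'}(A)-w_{\mu'}(B)\le\ell$ for all $(A,B)\in\tau$. *)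

theory Defs
  imports Complex_Main
begin

(* The unordered pair {A,B} is the set with elements A and B; the degenerate separation {V,V}
   is the singleton {V}, whose only orientation is (V,V). *)
definition is_separation :: "'a set \<Rightarrow> 'a set set \<Rightarrow> bool" where
  "is_separation V s \<longleftrightarrow>
     (\<exists>A B. s = {A, B} \<and> A \<subseteq> V \<and> B \<subseteq> V \<and> A \<union> B = V)"

definition orientations :: "'a set set \<Rightarrow> ('a set \<times> 'a set) set" where
  "orientations s = {(A, B). s = {A, B}}"

definition sep_le :: "'a set \<times> 'a set \<Rightarrow> 'a set \<times> 'a set \<Rightarrow> bool" where
  "sep_le = (\<lambda>(A, B) (C, D). A \<subseteq> C \<and> B \<supseteq> D)"

definition maximal_elements :: "('a set \<times> 'a set) set \<Rightarrow> ('a set \<times> 'a set) set" where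
  "maximal_elements \<tau> = {p \<in> \<tau>. \<forall>q\<in>\<tau>. sep_le p q \<longrightarrow> q = p}"

definition is_orientation :: "('a set \<times> 'a set) set \<Rightarrow> 'a set set set \<Rightarrow> bool" where
  "is_orientation \<tau> S \<longleftrightarrow>
     \<tau> \<subseteq> (\<Union>s\<in>S. orientations s) \<and> (\<forall>s\<in>S. \<exists>!p. p \<in> \<tau> \<and> p \<in> orientations s)"

(* Only the values of w on V matter; it is unconstrained elsewhere. *)
definition weight_function :: "'a set \<Rightarrow> ('a \<Rightarrow> real) \<Rightarrow> bool" where
  "weight_function V w \<longleftrightarrow> (\<forall>v\<in>V. 0 \<le> w v)"

definition induces :: "('a \<Rightarrow> real) \<Rightarrow> ('a set \<times> 'a set) set \<Rightarrow> bool" where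
  "induces w \<tau> \<longleftrightarrow> (\<forall>(A, B)\<in>\<tau>. sum w A < sum w B)"

definition locally_induced ::
    "'a set \<Rightarrow> nat \<Rightarrow> real \<Rightarrow> ('a set \<times> 'a set) set \<Rightarrow> bool" where
  "locally_induced V k l \<tau> \<longleftrightarrow>
     (\<forall>\<mu>. \<mu> \<subseteq> \<tau> \<and> finite \<mu> \<and> card \<mu> \<le> k \<longrightarrow>
        (\<exists>w. weight_function V w \<and>
             (\<forall>(A, B)\<in>\<mu>. sum w B - sum w A \<ge> 1) \<and>
             (\<forall>(A, B)\<in>\<tau>. sum w A - sum w B \<le> l)))"

end

theory Submission
  imports Defs
begin

text \<open>
  A weight function that induces \<open>\<tau>\<close> has a positive smallest gap \<open>w B - w A\<close>, because \<open>\<tau>\<close> is finite;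
  rescaling makes that gap at least 1, and the rescaled function serves as local witness for every
  choice of \<open>\<mu>\<close>, with any \<open>k\<close> and any nonnegative \<open>l\<close>.

  For the converse, passing to a larger separation can only shrink the gap of a nonnegative
  weight function, so it suffices to find positive gaps on the \<open>m\<close> maximal elements. The
  witness is an average: choose one local weight function \<open>W K\<close> for every set \<open>K\<close> of
  \<open>j = min k m\<close> maximal elements and add them all up. A fixed maximal element lies in the fraction
  \<open>j / m\<close> of these sets and gains at least 1 from each of them; each of the remaining sets, a
  fraction \<open>(m - j) / m\<close>, costs it at most \<open>l\<close>. So its gap is positive as soon as
  \<open>j > l * (m - j)\<close>, and this is the bound \<open>k > m / (1 + 1 / l)\<close> (or is trivial, if \<open>j = m\<close>).
  The counting is lemma \<open>sum_over_subsets_pos\<close>.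
\<close>

lemma sep_le_pairs: "sep_le p q \<longleftrightarrow> fst p \<subseteq> fst q \<and> snd q \<subseteq> snd p"
  by (cases p; cases q) (auto simp: sep_le_def)

lemma maximal_element_above:
  assumes "finite \<tau>" "p \<in> \<tau>"
  obtains q where "q \<in> maximal_elements \<tau>" "sep_le p q"
proof -
  let ?U = "{q \<in> \<tau>. sep_le p q}"
  let ?R = "\<lambda>q r. sep_le q r \<and> q \<noteq> r"
  have p: "p \<in> ?U"
    using assms(2) by (simp add: sep_le_pairs)
  have fin: "finite ?U" using assms(1) by simp
  have asymp: "asymp_on ?U ?R"
    by (rule asymp_onI) (simp add: sep_le_pairs prod_eq_iff, blast)
  have transp: "transp_on ?U ?R"
    by (rule transp_onI) (simp add: sep_le_pairs prod_eq_iff, blast)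
  have "?U \<noteq> {}" using p by (rule ex_in_conv[THEN iffD1, OF exI])
  from Finite_Set.bex_max_element[OF fin asymp transp this]
  obtain q where q: "q \<in> ?U" "\<forall>r\<in>?U. r \<noteq> q \<longrightarrow> \<not> ?R q r"
    by (rule bexE)
  have "r = q" if "r \<in> \<tau>" "sep_le q r" for r
  proof -
    have "sep_le p r" using q(1) that(2) by (simp add: sep_le_pairs, blast)
    with that q(2) show ?thesis by (metis (mono_tags, lifting) mem_Collect_eq)
  qed
  with q(1) show thesis
    by (intro that[of q]) (simp_all add: maximal_elements_def)
qed

lemma gap_antimono:
  assumes "finite V" "weight_function V w" "B \<subseteq> V" "C \<subseteq> V" "sep_le (A, B) (C, D)"
  shows "sum w D - sum w C \<le> sum w B - sum w A"
proof -
  have "A \<subseteq> C" "D \<subseteq> B" using assms(5) by (auto simp: sep_le_def)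
  then have "sum w A \<le> sum w C" "sum w D \<le> sum w B"
    using assms by (auto intro!: sum_mono2 simp: weight_function_def finite_subset)
  then show ?thesis by simp
qed

lemma orientation_subset_Pow:
  assumes "\<forall>s\<in>S. is_separation V s" "is_orientation \<tau> S"
  shows "\<tau> \<subseteq> Pow V \<times> Pow V"
proof -
  have "A \<subseteq> V \<and> B \<subseteq> V" if "(A, B) \<in> \<tau>" for A B
  proof -
    from that assms obtain s where "s \<in> S" "s = {A, B}"
      by (auto simp: is_orientation_def orientations_def)
    with assms(1) show ?thesis
      by (fastforce simp: is_separation_def doubleton_eq_iff)
  qed
  then show ?thesis by auto
qed

text \<open>
  Double counting: \<open>p\<close> is missing from \<open>card M - 1 choose j\<close> of the \<open>j\<close>-subsets of \<open>M\<close>. By absorption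
  this is the fraction \<open>(card M - j) / card M\<close> of all of them, so a gain of 1 from each set
  containing \<open>p\<close> outweighs a loss of \<open>l\<close> from each other set exactly if \<open>l * (card M - j) < j\<close>.
\<close>

lemma sum_over_subsets_pos:
  fixes f :: "'b set \<Rightarrow> real"
  assumes M: "finite M" "p \<in> M" "j \<le> card M"
    and j: "l * (real (card M) - real j) < real j"
    and gain: "\<And>K. K \<subseteq> M \<Longrightarrow> card K = j \<Longrightarrow> p \<in> K \<Longrightarrow> 1 \<le> f K"
    and loss: "\<And>K. K \<subseteq> M \<Longrightarrow> card K = j \<Longrightarrow> - l \<le> f K"
  shows "0 < sum f {K. K \<subseteq> M \<and> card K = j}"
proof -
  let ?m = "card M"
  define all where "all = {K. K \<subseteq> M \<and> card K = j}"
  define miss where "miss = {K. K \<subseteq> M - {p} \<and> card K = j}"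
  have fin: "finite all" and sub: "miss \<subseteq> all"
    using M(1) by (auto simp: all_def miss_def)
  have card_all: "card all = ?m choose j"
    unfolding all_def by (rule n_subsets[OF M(1)])
  have card_miss: "card miss = (?m - 1) choose j"
    unfolding miss_def using n_subsets[of "M - {p}" j] M by simp
  have m_pos: "0 < ?m" using M by (auto simp: card_gt_0_iff)
  have all_pos: "0 < real (card all)" using card_all M(3) by simp
  have absorb: "real ?m * real (card miss) = (real ?m - real j) * real (card all)"
    using arg_cong[OF binomial_absorb_comp[of ?m j], of real] M(3)
    by (simp add: card_all card_miss of_nat_diff)
  have "real ?m * (real (card all) - (1 + l) * real (card miss))
      = real ?m * real (card all) - (1 + l) * (real ?m * real (card miss))"
    by (simp add: algebra_simps)
  also have "\<dots> = (real j - l * (real ?m - real j)) * real (card all)"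
    unfolding absorb by (simp add: algebra_simps)
  also have "\<dots> > 0" using all_pos j by simp
  finally have "0 < real (card all) - (1 + l) * real (card miss)"
    using m_pos by (simp add: zero_less_mult_iff)
  also have "\<dots> = real (card (all - miss)) - l * real (card miss)"
    using fin sub by (simp add: card_Diff_subset finite_subset card_mono of_nat_diff algebra_simps)
  also have "\<dots> = (\<Sum>K\<in>all - miss. 1) + (\<Sum>K\<in>miss. - l)"
    by simp
  also have "\<dots> \<le> sum f (all - miss) + sum f miss"
    using gain loss by (intro add_mono sum_mono) (auto simp: all_def miss_def)
  also have "\<dots> = sum f all"
    using sum.subset_diff[OF sub fin, of f] by simp
  finally show ?thesis by (simp add: all_def)
qed

lemma induced_if_locally_induced:
  fixes l :: real
  assumes V: "finite V" and \<tau>: "\<tau> \<subseteq> Pow V \<times> Pow V"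
    and l: "0 < l" and k: "real (card (maximal_elements \<tau>)) / (1 + 1 / l) < real k"
    and loc: "locally_induced V k l \<tau>"
  shows "\<exists>w. weight_function V w \<and> induces w \<tau>"
proof -
  define M where "M = maximal_elements \<tau>"
  define j where "j = min k (card M)"
  define F where "F = {K. K \<subseteq> M \<and> card K = j}"
  have fin_\<tau>: "finite \<tau>"
    using V \<tau> by (meson finite_Pow_iff finite_SigmaI finite_subset)
  have M_sub: "M \<subseteq> \<tau>" by (auto simp: M_def maximal_elements_def)
  then have fin_M: "finite M" using fin_\<tau> by (rule finite_subset)
  have "\<exists>w. weight_function V w \<and> (\<forall>(A, B)\<in>K. sum w B - sum w A \<ge> 1) \<and>
          (\<forall>(A, B)\<in>\<tau>. sum w A - sum w B \<le> l)" if "K \<in> F" for K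
  proof -
    have "K \<subseteq> \<tau>" "finite K" "card K \<le> k"
      using that M_sub fin_M by (auto simp: F_def j_def dest: finite_subset)
    then show ?thesis
      using loc[unfolded locally_induced_def, THEN spec, of K] by simp
  qed
  then obtain W where W: "\<And>K. K \<in> F \<Longrightarrow> weight_function V (W K) \<and>
          (\<forall>(A, B)\<in>K. sum (W K) B - sum (W K) A \<ge> 1) \<and>
          (\<forall>(A, B)\<in>\<tau>. sum (W K) A - sum (W K) B \<le> l)"
    by metis
  define w where "w v = (\<Sum>K\<in>F. W K v)" for v
  have weight: "weight_function V w"
    using W by (auto simp: weight_function_def w_def intro!: sum_nonneg)
  have gap: "sum w B - sum w A = (\<Sum>K\<in>F. sum (W K) B - sum (W K) A)" for A B
    unfolding w_def by (subst (1 2) sum.swap) (simp add: sum_subtractf)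
  have pos: "0 < sum w D - sum w C" if CD: "(C, D) \<in> M" for C D
  proof -
    have "0 < card M" using CD fin_M by (auto simp: card_gt_0_iff)
    moreover have "l * real (card M) < real k * (1 + l)"
      using k l by (simp add: M_def field_simps)
    ultimately have j: "l * (real (card M) - real j) < real j"
      by (cases "k \<le> card M") (auto simp: j_def algebra_simps)
    have "0 < (\<Sum>K | K \<subseteq> M \<and> card K = j. sum (W K) D - sum (W K) C)"
    proof (rule sum_over_subsets_pos[OF fin_M CD _ j])
      show "j \<le> card M" by (simp add: j_def)
    next
      fix K assume "K \<subseteq> M" "card K = j"
      then have "K \<in> F" by (simp add: F_def)
      note WK = W[OF this]
      show "- l \<le> sum (W K) D - sum (W K) C"
        using WK subsetD[OF M_sub CD] by auto
      show "1 \<le> sum (W K) D - sum (W K) C" if "(C, D) \<in> K"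
        using WK that by auto
    qed
    then show ?thesis by (simp add: gap F_def)
  qed
  have "sum w A < sum w B" if AB: "(A, B) \<in> \<tau>" for A B
  proof -
    from maximal_element_above[OF fin_\<tau> AB] obtain C D
      where CD: "(C, D) \<in> M" "sep_le (A, B) (C, D)"
      unfolding M_def by (metis surj_pair)
    have "B \<subseteq> V" "C \<subseteq> V" using AB CD M_sub \<tau> by auto
    with gap_antimono[OF V weight _ _ CD(2)] pos[OF CD(1)] show ?thesis by simp
  qed
  with weight show ?thesis by (auto simp: induces_def)
qed

lemma locally_induced_if_induced:
  assumes "finite \<tau>" "0 \<le> l" and w: "weight_function V w" "induces w \<tau>"
  shows "locally_induced V k l \<tau>"
proof -
  \<comment> \<open>The added 1 keeps the minimum defined when \<open>\<tau>\<close> is empty.\<close>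
  define d where "d = Min (insert 1 ((\<lambda>(A, B). sum w B - sum w A) ` \<tau>))"
  have d: "0 < d"
    using assms by (auto simp: d_def induces_def)
  have d_le: "d \<le> sum w B - sum w A" if "(A, B) \<in> \<tau>" for A B
    using assms(1) that unfolding d_def by (intro Min_le) force+
  define u where "u v = w v / d" for v
  have u: "weight_function V u"
    using w d by (simp add: u_def weight_function_def)
  have gap: "1 \<le> sum u B - sum u A" if "(A, B) \<in> \<tau>" for A B
    using d_le[OF that] d
    by (simp add: u_def flip: sum_divide_distrib diff_divide_distrib)
  have "sum u A - sum u B \<le> l" if "(A, B) \<in> \<tau>" for A B
    using gap[OF that] assms(2) by simp
  with u gap show ?thesis
    unfolding locally_induced_def by (intro allI impI exI[of _ u]) auto
qed

theorem theorem7: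
  fixes V :: "'a set" and S :: "'a set set set"
    and \<tau> :: "('a set \<times> 'a set) set" and m :: nat
  assumes "finite V"
    and "\<forall>s\<in>S. is_separation V s"
    and "is_orientation \<tau> S"
    and "card (maximal_elements \<tau>) = m"
  shows "(\<exists>w :: 'a \<Rightarrow> real. weight_function V w \<and> induces w \<tau>) \<longleftrightarrow>
         (\<exists>(k::nat) (l::real). l > 0 \<and> real k > real m / (1 + 1 / l) \<and> locally_induced V k l \<tau>)"
proof
  have \<tau>: "\<tau> \<subseteq> Pow V \<times> Pow V"
    using assms(2,3) by (rule orientation_subset_Pow)
  {
    assume "\<exists>w :: 'a \<Rightarrow> real. weight_function V w \<and> induces w \<tau>"
    moreover have "finite \<tau>"
      using assms(1) \<tau> by (meson finite_Pow_iff finite_SigmaI finite_subset)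
    ultimately have "locally_induced V (Suc m) 1 \<tau>"
      using locally_induced_if_induced[of \<tau> 1] by auto
    then show "\<exists>(k::nat) (l::real). l > 0 \<and> real k > real m / (1 + 1 / l) \<and> locally_induced V k l \<tau>"
      by (intro exI[of _ "Suc m"] exI[of _ "1::real"]) simp
  next
    assume "\<exists>(k::nat) (l::real). l > 0 \<and> real k > real m / (1 + 1 / l) \<and> locally_induced V k l \<tau>"
    then show "\<exists>w :: 'a \<Rightarrow> real. weight_function V w \<and> induces w \<tau>"
      using induced_if_locally_induced[OF assms(1) \<tau>] assms(4) by blast
  }
qed

end
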